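(* Let $\mathcal{V}$ be a variety of algebras with a unique constant $0$ and a given $(n+1)$-ary term $\theta$ such that $\theta(0,\dots,0,x)=x$ holds in $\mathcal{V}$. Let $X \xrightarrow{k} A \xrightarrow{p} B$, with section $s\colon B\to A$ of $p$, be a $\theta$-weakly-Schreier split extension of $\mathcal{V}$-algebras. Then it is isomorphic to a split extension $X\xrightarrow{k'}Y\xrightarrow{\pi_B}B$ with section $\iota_B\colon B\to Y$, where $Y$ is a certain subset of $X^n\times B$, $\pi_B(\vec{x},b)=b$, $\iota_B(b)=(0,\dots,0,b)$, and $k'(x)$ is the unique element $(\vec{y},0)\in Y$ such that $\theta_X(\vec{y},0)=x$. Moreover, suppose the maps $q_1,\dots,q_n\colon A\to X$ witness the $\theta$-weakly-Schreier condition. For each basic operation $\omega$ of the variety, of arity $m$, define a map $\vec{\gamma}_\omega\colon (X^n\times B)^m\to X^n$ by $$\bigl(\vec{\gamma}_\omega(x^1_1,\dots,x^1_n,b^1,\dots,x^m_1,\dots,x^m_n,b^m)\bigr)_i = q_i\bigl(\omega(\theta(k x^1_1,\dots,k x^1_n,s b^1),\dots,\theta(k x^m_1,\dots,k x^m_n,s b^m))\bigr)$$ for $i=1,\dots,n$. (The maps $\vec{\gamma}_\omega$ for composite terms $\omega$ can be defined in terms of these as necessary; they are given by the same formula.) Then $Y$ is given by $$\{(\vec{x},b)\in X^n\times B \mid \vec{\gamma}_{\mathrm{id}}(\vec{x},b)=\vec{x}\},$$ or, equivalently, by $$\{(\vec{x},b)\in X^n\times B\mid \vec{\gamma}_\theta(\vec{0},\vec{x},b)=\vec{x}\},$$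 equipped with operations $\omega_Y$ defined by $$\omega_Y(\vec{x}^1,b^1,\dots,\vec{x}^m,b^m)=\bigl(\vec{\gamma}_\omega(\vec{x}^1,b^1,\dots,\vec{x}^m,b^m),\,\omega_B(b^1,\dots,b^m)\bigr).$$
   Context: The category of $\mathcal{V}$-algebras and homomorphisms is pointed, with zero morphisms the constant maps at $0$, so kernels can be defined: the kernel of a homomorphism $p\colon A\to B$ is the inclusion of $\{a\in A\mid p(a)=0\}$. A split extension is a diagram of homomorphisms $k\colon X\to A$, $p\colon A\to B$, $s\colon B\to A$ in which $k$ is the kernel of $p$ and $ps=\mathrm{id}_B$. Two split extensions with the same kernel object $X$ and quotient $B$ are isomorphic if there is an isomorphism between their middle algebras commuting with the kernel maps, the quotient maps and the sections. A split extension $(k,p,s)$ is $\theta$-weakly-Schreier if there exist $n$ functions $q_1,\dots,q_n\colon A\to X$ (not required to be homomorphisms) such that $\theta(kq_1(a),\dots,kq_n(a),sp(a))=a$ for all $a\in A$; such functions are said to witness the $\theta$-weakly-Schreier condition. One may always assume $q_i(0)=0$ for each $i$, and this is assumed here. Notation: $\vec{x}=(x_1,\dots,x_n)$ and $\vec{x}^j=(x^j_1,\dots,x^j_n)$ are tuples of elements of $X$; $\mathrm{id}$ is the unary term $\mathrm{id}(x)=x$; in $\vec{\gamma}_\theta(\vec{0},\vec{x},b)$ each of the first $n$ arguments from $X^n\times B$ is the zero element $(0,\dots,0,0)$ and the last is $(\vec{x},b)$. Subscripts such as $\omega_B$, $\theta_X$ denote the interpretation of an operation or term in the indicated algebra.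 Brackets around single arguments of functions are sometimes omitted, e.g. $kx=k(x)$.
   Formalization: For Y built from given witnesses with only q_i(0)=0, ι_B need not land in Y; the section ι_B is therefore claimed only when q_i(s(b))=0 for all b (such witnesses always exist), and otherwise the section is b ↦ (q_1(s(b)),…,q_n(s(b)),b). *)

theory Defs
  imports Main "HOL-Library.NList"
begin

section \<open>Terms, algebras and varieties\<close>

text \<open>A signature is a type \<open>'f\<close> of operation symbols with an arity function \<open>ar :: 'f \<Rightarrow> nat\<close>.\<close>

datatype ('f, tvars: 'v) trm = Var 'v | Op 'f "('f, 'v) trm list"

fun wf_trm :: "('f \<Rightarrow> nat) \<Rightarrow> ('f, 'v) trm \<Rightarrow> bool" where
  "wf_trm ar (Var x) \<longleftrightarrow> True"
| "wf_trm ar (Op f ts) \<longleftrightarrow> length ts = ar f \<and> (\<forall>t\<in>set ts. wf_trm ar t)"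

primrec subst :: "('v \<Rightarrow> ('f, 'w) trm) \<Rightarrow> ('f, 'v) trm \<Rightarrow> ('f, 'w) trm" where
  "subst \<sigma> (Var x) = \<sigma> x"
| "subst \<sigma> (Op f ts) = Op f (map (subst \<sigma>) ts)"

text \<open>An \<open>m\<close>-ary term is a term in the variables \<open>0, \<dots>, m - 1\<close>.\<close>

definition nary_term :: "('f \<Rightarrow> nat) \<Rightarrow> nat \<Rightarrow> ('f, nat) trm \<Rightarrow> bool" where
  "nary_term ar m t \<longleftrightarrow> wf_trm ar t \<and> tvars t \<subseteq> {..<m}"

record ('f, 'a) algebra =
  carrier :: "'a set"
  interp :: "'f \<Rightarrow> 'a list \<Rightarrow> 'a"

primrec eval :: "('f, 'a) algebra \<Rightarrow> ('v \<Rightarrow> 'a) \<Rightarrow> ('f, 'v) trm \<Rightarrow> 'a" where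
  "eval M v (Var x) = v x"
| "eval M v (Op f ts) = interp M f (map (eval M v) ts)"

definition term_op :: "('f, 'a) algebra \<Rightarrow> ('f, nat) trm \<Rightarrow> 'a list \<Rightarrow> 'a" where
  "term_op M t xs = eval M (nth xs) t"

definition is_algebra :: "('f \<Rightarrow> nat) \<Rightarrow> ('f, 'a) algebra \<Rightarrow> bool" where
  "is_algebra ar M \<longleftrightarrow> (\<forall>f. \<forall>xs\<in>nlists (ar f) (carrier M). interp M f xs \<in> carrier M)"

type_synonym 'f identity = "('f, nat) trm \<times> ('f, nat) trm"

definition satisfies :: "('f, 'a) algebra \<Rightarrow> 'f identity \<Rightarrow> bool" where
  "satisfies M e \<longleftrightarrow> (\<forall>v. range v \<subseteq> carrier M \<longrightarrow> eval M v (fst e) = eval M v (snd e))"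

text \<open>The variety presented by a set \<open>E\<close> of identities consists of the following algebras,
  on carriers of any type.\<close>

definition wf_identities :: "('f \<Rightarrow> nat) \<Rightarrow> 'f identity set \<Rightarrow> bool" where
  "wf_identities ar E \<longleftrightarrow> (\<forall>(t, u)\<in>E. wf_trm ar t \<and> wf_trm ar u)"

definition in_variety :: "('f \<Rightarrow> nat) \<Rightarrow> 'f identity set \<Rightarrow> ('f, 'a) algebra \<Rightarrow> bool" where
  "in_variety ar E M \<longleftrightarrow> is_algebra ar M \<and> (\<forall>e\<in>E. satisfies M e)"

text \<open>An identity holds in a variety if all algebras of the variety satisfy it. A formula cannot
  quantify over the carrier type; the type of sets of terms suffices, since it carries (as congruence
  classes of terms) the free algebra on countably many generators and all its quotients. Lemma
  \<open>holds_in_variety_satisfies\<close> below confirms that the identity then holds in the algebras of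
  the variety on every type.\<close>

definition holds_in_variety :: "('f \<Rightarrow> nat) \<Rightarrow> 'f identity set \<Rightarrow> 'f identity \<Rightarrow> bool" where
  "holds_in_variety ar E e \<longleftrightarrow>
     (\<forall>M :: ('f, ('f, nat) trm set) algebra. in_variety ar E M \<longrightarrow> satisfies M e)"

text \<open>\<open>z\<close> is the unique constant of the variety: it is a nullary operation, and every closed
  term equals it. In particular \<open>\<omega>(0, \<dots>, 0) = 0\<close> for all operations \<open>\<omega>\<close>, which makes the category of
  algebras pointed.\<close>

definition unique_constant :: "('f \<Rightarrow> nat) \<Rightarrow> 'f identity set \<Rightarrow> 'f \<Rightarrow> bool" where
  "unique_constant ar E z \<longleftrightarrow> ar z = 0 \<and>
     (\<forall>t. nary_term ar 0 t \<longrightarrow> holds_in_variety ar E (t, Op z []))"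

abbreviation zero :: "'f \<Rightarrow> ('f, 'a) algebra \<Rightarrow> 'a" where
  "zero z M \<equiv> interp M z []"

text \<open>The identity \<open>\<theta>(0, \<dots>, 0, x) = x\<close> for an \<open>(n + 1)\<close>-ary term.\<close>

definition theta_identity :: "'f \<Rightarrow> nat \<Rightarrow> ('f, nat) trm \<Rightarrow> 'f identity" where
  "theta_identity z n \<theta> = (subst (nth (replicate n (Op z []) @ [Var 0])) \<theta>, Var 0)"

section \<open>Homomorphisms and split extensions\<close>

definition hom :: "('f \<Rightarrow> nat) \<Rightarrow> ('f, 'a) algebra \<Rightarrow> ('f, 'b) algebra \<Rightarrow> ('a \<Rightarrow> 'b) \<Rightarrow> bool" where
  "hom ar M N h \<longleftrightarrow> h ` carrier M \<subseteq> carrier N \<and>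
     (\<forall>f. \<forall>xs\<in>nlists (ar f) (carrier M). h (interp M f xs) = interp N f (map h xs))"

definition iso :: "('f \<Rightarrow> nat) \<Rightarrow> ('f, 'a) algebra \<Rightarrow> ('f, 'b) algebra \<Rightarrow> ('a \<Rightarrow> 'b) \<Rightarrow> bool" where
  "iso ar M N h \<longleftrightarrow> hom ar M N h \<and> bij_betw h (carrier M) (carrier N)"

text \<open>As usual in a category, kernels are taken up to isomorphism: \<open>k\<close> identifies \<open>X\<close> with
  the subalgebra \<open>{a \<in> A. p a = 0}\<close>.\<close>

definition is_kernel :: "('f \<Rightarrow> nat) \<Rightarrow> 'f \<Rightarrow> ('f, 'x) algebra \<Rightarrow> ('x \<Rightarrow> 'a) \<Rightarrow> ('f, 'a) algebra
    \<Rightarrow> ('a \<Rightarrow> 'b) \<Rightarrow> ('f, 'b) algebra \<Rightarrow> bool" where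
  "is_kernel ar z X k A p B \<longleftrightarrow>
     hom ar X A k \<and> bij_betw k (carrier X) {a \<in> carrier A. p a = zero z B}"

definition split_extension :: "('f \<Rightarrow> nat) \<Rightarrow> 'f identity set \<Rightarrow> 'f \<Rightarrow> ('f, 'x) algebra \<Rightarrow> ('x \<Rightarrow> 'a)
    \<Rightarrow> ('f, 'a) algebra \<Rightarrow> ('a \<Rightarrow> 'b) \<Rightarrow> ('b \<Rightarrow> 'a) \<Rightarrow> ('f, 'b) algebra \<Rightarrow> bool" where
  "split_extension ar E z X k A p s B \<longleftrightarrow>
     in_variety ar E X \<and> in_variety ar E A \<and> in_variety ar E B \<and>
     hom ar A B p \<and> hom ar B A s \<and> is_kernel ar z X k A p B \<and> (\<forall>b\<in>carrier B. p (s b) = b)"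

definition split_ext_isomorphic :: "('f \<Rightarrow> nat) \<Rightarrow> ('f, 'x) algebra \<Rightarrow> ('f, 'b) algebra
    \<Rightarrow> ('x \<Rightarrow> 'a) \<Rightarrow> ('f, 'a) algebra \<Rightarrow> ('a \<Rightarrow> 'b) \<Rightarrow> ('b \<Rightarrow> 'a)
    \<Rightarrow> ('x \<Rightarrow> 'y) \<Rightarrow> ('f, 'y) algebra \<Rightarrow> ('y \<Rightarrow> 'b) \<Rightarrow> ('b \<Rightarrow> 'y) \<Rightarrow> bool" where
  "split_ext_isomorphic ar X B k A p s k' A' p' s' \<longleftrightarrow>
     (\<exists>\<phi>. iso ar A A' \<phi> \<and> (\<forall>x\<in>carrier X. \<phi> (k x) = k' x) \<and>
          (\<forall>a\<in>carrier A. p' (\<phi> a) = p a) \<and> (\<forall>b\<in>carrier B. \<phi> (s b) = s' b))"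

text \<open>The functions \<open>q\<^sub>1, \<dots>, q\<^sub>n\<close> are \<open>q 0, \<dots>, q (n - 1)\<close>; elements of \<open>X\<^sup>n\<close> are lists of length \<open>n\<close>.\<close>

definition schreier_witness :: "nat \<Rightarrow> ('f, nat) trm \<Rightarrow> ('f, 'x) algebra \<Rightarrow> ('x \<Rightarrow> 'a)
    \<Rightarrow> ('f, 'a) algebra \<Rightarrow> ('a \<Rightarrow> 'b) \<Rightarrow> ('b \<Rightarrow> 'a) \<Rightarrow> (nat \<Rightarrow> 'a \<Rightarrow> 'x) \<Rightarrow> bool" where
  "schreier_witness n \<theta> X k A p s q \<longleftrightarrow>
     (\<forall>i<n. q i ` carrier A \<subseteq> carrier X) \<and>
     (\<forall>a\<in>carrier A. term_op A \<theta> (map (\<lambda>i. k (q i a)) [0..<n] @ [s (p a)]) = a)"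

definition weakly_schreier :: "('f \<Rightarrow> nat) \<Rightarrow> 'f identity set \<Rightarrow> 'f \<Rightarrow> nat \<Rightarrow> ('f, nat) trm
    \<Rightarrow> ('f, 'x) algebra \<Rightarrow> ('x \<Rightarrow> 'a) \<Rightarrow> ('f, 'a) algebra \<Rightarrow> ('a \<Rightarrow> 'b) \<Rightarrow> ('b \<Rightarrow> 'a)
    \<Rightarrow> ('f, 'b) algebra \<Rightarrow> bool" where
  "weakly_schreier ar E z n \<theta> X k A p s B \<longleftrightarrow>
     split_extension ar E z X k A p s B \<and> (\<exists>q. schreier_witness n \<theta> X k A p s q)"

text \<open>\<open>gamma n \<theta> k A s q \<omega>\<close> is \<open>\<gamma>\<^sub>\<omega>\<close> for an operation \<open>\<omega>\<close> of \<open>A\<close>, which may be a basic operation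
  \<open>interp A f\<close> or a term operation \<open>term_op A t\<close>. Its argument is a list of elements of \<open>X\<^sup>n \<times> B\<close>.\<close>

definition gamma :: "nat \<Rightarrow> ('f, nat) trm \<Rightarrow> ('x \<Rightarrow> 'a) \<Rightarrow> ('f, 'a) algebra \<Rightarrow> ('b \<Rightarrow> 'a)
    \<Rightarrow> (nat \<Rightarrow> 'a \<Rightarrow> 'x) \<Rightarrow> ('a list \<Rightarrow> 'a) \<Rightarrow> ('x list \<times> 'b) list \<Rightarrow> 'x list" where
  "gamma n \<theta> k A s q \<omega> ws =
     map (\<lambda>i. q i (\<omega> (map (\<lambda>(xs, b). term_op A \<theta> (map k xs @ [s b])) ws))) [0..<n]"

definition Y_algebra :: "nat \<Rightarrow> ('f, nat) trm \<Rightarrow> ('f, 'x) algebra \<Rightarrow> ('x \<Rightarrow> 'a) \<Rightarrow> ('f, 'a) algebra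
    \<Rightarrow> ('b \<Rightarrow> 'a) \<Rightarrow> ('f, 'b) algebra \<Rightarrow> (nat \<Rightarrow> 'a \<Rightarrow> 'x) \<Rightarrow> ('f, 'x list \<times> 'b) algebra" where
  "Y_algebra n \<theta> X k A s B q =
     \<lparr> carrier = {(xs, b) \<in> nlists n (carrier X) \<times> carrier B.
                    gamma n \<theta> k A s q (term_op A (Var 0)) [(xs, b)] = xs},
       interp = (\<lambda>f ws. (gamma n \<theta> k A s q (interp A f) ws, interp B f (map snd ws))) \<rparr>"

definition kernel_elt :: "'f \<Rightarrow> ('f, nat) trm \<Rightarrow> ('f, 'x) algebra \<Rightarrow> ('f, 'b) algebra
    \<Rightarrow> ('f, 'x list \<times> 'b) algebra \<Rightarrow> 'x \<Rightarrow> 'x list \<times> 'b \<Rightarrow> bool" where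
  "kernel_elt z \<theta> X B Y x w \<longleftrightarrow>
     w \<in> carrier Y \<and> snd w = zero z B \<and> term_op X \<theta> (fst w @ [zero z X]) = x"

definition kernel_map :: "'f \<Rightarrow> ('f, nat) trm \<Rightarrow> ('f, 'x) algebra \<Rightarrow> ('f, 'b) algebra
    \<Rightarrow> ('f, 'x list \<times> 'b) algebra \<Rightarrow> 'x \<Rightarrow> 'x list \<times> 'b" where
  "kernel_map z \<theta> X B Y x = (THE w. kernel_elt z \<theta> X B Y x w)"

text \<open>\<open>iota\<close> maps into \<open>Y\<close> only if \<open>q\<^sub>i (s b) = 0\<close> for all \<open>b\<close>; the condition \<open>q\<^sub>i 0 = 0\<close> is weaker.
  For general \<open>q\<close> the section corresponding to \<open>s\<close> is \<open>b \<mapsto> (q\<^sub>1 (s b), \<dots>, q\<^sub>n (s b), b)\<close>.\<close>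

definition iota :: "'f \<Rightarrow> nat \<Rightarrow> ('f, 'x) algebra \<Rightarrow> 'b \<Rightarrow> 'x list \<times> 'b" where
  "iota z n X b = (replicate n (zero z X), b)"

section \<open>Identities that hold in a variety\<close>

lemma eval_closed:
  assumes "is_algebra ar M" "range v \<subseteq> carrier M" "wf_trm ar t"
  shows "eval M v t \<in> carrier M"
  using assms(3)
proof (induction t)
  case (Var x)
  then show ?case using assms(2) by auto
next
  case (Op f ts)
  then have "map (eval M v) ts \<in> nlists (ar f) (carrier M)"
    by (auto intro!: nlistsI)
  then show ?case using assms(1) by (simp add: is_algebra_def)
qed

lemma eval_hom:
  assumes "is_algebra ar M" "hom ar M N h" "range v \<subseteq> carrier M" "wf_trm ar t"
  shows "h (eval M v t) = eval N (\<lambda>x. h (v x)) t"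
  using assms(4)
proof (induction t)
  case (Var x)
  then show ?case by simp
next
  case (Op f ts)
  then have "map (eval M v) ts \<in> nlists (ar f) (carrier M)"
    using eval_closed[OF assms(1,3)] by (auto intro!: nlistsI)
  then have "h (interp M f (map (eval M v) ts)) = interp N f (map h (map (eval M v) ts))"
    using assms(2) by (simp add: hom_def)
  also have "map h (map (eval M v) ts) = map (eval N (\<lambda>x. h (v x))) ts"
    using Op by auto
  finally show ?case by simp
qed

lemma in_variety_inj_hom:
  assumes "wf_identities ar E" "in_variety ar E M" "is_algebra ar N" "hom ar N M h"
    "inj_on h (carrier N)"
  shows "in_variety ar E N"
proof -
  have "satisfies N e" if "e \<in> E" for e
    unfolding satisfies_def
  proof (intro allI impI)
    fix v :: "nat \<Rightarrow> _" assume v: "range v \<subseteq> carrier N"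
    have wf: "wf_trm ar (fst e)" "wf_trm ar (snd e)"
      using assms(1) that by (auto simp: wf_identities_def)
    have "range (\<lambda>x. h (v x)) \<subseteq> carrier M"
      using v assms(4) by (force simp: hom_def)
    then have "eval M (\<lambda>x. h (v x)) (fst e) = eval M (\<lambda>x. h (v x)) (snd e)"
      using assms(2) that by (simp add: in_variety_def satisfies_def)
    then have "h (eval N v (fst e)) = h (eval N v (snd e))"
      using eval_hom[OF assms(3,4) v] wf by simp
    then show "eval N v (fst e) = eval N v (snd e)"
      using assms(5) eval_closed[OF assms(3) v] wf by (auto dest: inj_onD)
  qed
  then show ?thesis using assms(3) by (simp add: in_variety_def)
qed

lemma holds_in_variety_satisfies:
  fixes M :: "('f, 'a) algebra"
  assumes E: "wf_identities ar E" and holds: "holds_in_variety ar E e"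
    and wf: "wf_trm ar (fst e)" "wf_trm ar (snd e)" and M: "in_variety ar E M"
  shows "satisfies M e"
  unfolding satisfies_def
proof (intro allI impI)
  fix v :: "nat \<Rightarrow> 'a" assume v: "range v \<subseteq> carrier M"
  have algM: "is_algebra ar M" using M by (simp add: in_variety_def)
  define cl where "cl t = {u. wf_trm ar u \<and> eval M v u = eval M v t}" for t
  define rep where "rep C = (SOME t. t \<in> C)" for C :: "('f, nat) trm set"
  define g where "g C = eval M v (rep C)" for C
  define N where "N = \<lparr>carrier = cl ` {t. wf_trm ar t}, interp = (\<lambda>f Cs. cl (Op f (map rep Cs)))\<rparr>"
  have rep: "rep (cl t) \<in> cl t" if "wf_trm ar t" for t
    unfolding rep_def by (rule someI[of _ t]) (simp add: cl_def that)
  then have wf_rep: "wf_trm ar (rep C)" if "C \<in> carrier N" for C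
    using that by (auto simp: N_def cl_def)
  have g_cl: "g (cl t) = eval M v t" if "wf_trm ar t" for t
    using rep[OF that] by (simp add: g_def cl_def)
  have algN: "is_algebra ar N"
    unfolding is_algebra_def
  proof (intro allI ballI)
    fix f Cs assume "Cs \<in> nlists (ar f) (carrier N)"
    then have "length Cs = ar f" "\<And>C. C \<in> set Cs \<Longrightarrow> wf_trm ar (rep C)"
      using wf_rep by (simp, meson nlistsE_set subsetD)
    then have "wf_trm ar (Op f (map rep Cs))" by simp
    then show "interp N f Cs \<in> carrier N" by (auto simp: N_def)
  qed
  have hom: "hom ar N M g"
    unfolding hom_def
  proof (intro conjI allI ballI)
    show "g ` carrier N \<subseteq> carrier M"
      using eval_closed[OF algM v] wf_rep by (auto simp: g_def)
  next
    fix f Cs assume "Cs \<in> nlists (ar f) (carrier N)"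
    then have "length Cs = ar f" "\<And>C. C \<in> set Cs \<Longrightarrow> wf_trm ar (rep C)"
      using wf_rep by (simp, meson nlistsE_set subsetD)
    then have "wf_trm ar (Op f (map rep Cs))" by simp
    then have "g (interp N f Cs) = eval M v (Op f (map rep Cs))"
      using g_cl by (simp add: N_def)
    also have "\<dots> = interp M f (map g Cs)"
      by (simp add: g_def comp_def cong: map_cong)
    finally show "g (interp N f Cs) = interp M f (map g Cs)" .
  qed
  have "inj_on g (carrier N)"
    by (rule inj_onI) (auto simp: N_def g_cl, auto simp: cl_def)
  then have "in_variety ar E N"
    using in_variety_inj_hom[OF E M algN hom] by simp
  then have "satisfies N e" using holds by (simp add: holds_in_variety_def)
  moreover have w: "range (\<lambda>i. cl (Var i)) \<subseteq> carrier N"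
    by (auto simp: N_def)
  ultimately have "g (eval N (\<lambda>i. cl (Var i)) (fst e)) = g (eval N (\<lambda>i. cl (Var i)) (snd e))"
    by (simp add: satisfies_def)
  moreover have "(\<lambda>i. g (cl (Var i))) = v" by (simp add: g_cl)
  ultimately show "eval M v (fst e) = eval M v (snd e)"
    using eval_hom[OF algN hom w] wf by simp
qed

end

(*
  A witness q_1, ..., q_n embeds A into X^n x B by phi a = (q_1 a, ..., q_n a, p a). The
  weakly-Schreier condition says that T (xs, b) = theta (k xs, s b) is a left inverse of phi, and
  applying p to theta (0, ..., 0, b) = b shows that p (T (xs, b)) = b. Hence the image of phi
  consists of the fixed points of phi o T, that is, of the (xs, b) with gamma_id (xs, b) = xs, and the
  operations of Y are those of A transported along phi. Since k theta_X (ys, 0) = T (ys, 0), the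
  element (ys, 0) of Y with theta_X (ys, 0) = x can only be phi (k x). Resetting the q_i to 0 on the
  image of s yields a witness for which phi s = iota.
*)
theory Submission
  imports Defs
begin

(* As simp rules they loop with nlists_def: their premises unfold to their own left-hand sides. *)
declare nlistsE_length [simp del] nlistsE_set [simp del]

section \<open>Term operations\<close>

lemma eval_cong_tvars:
  assumes "\<And>x. x \<in> tvars t \<Longrightarrow> v x = w x"
  shows "eval M v t = eval M w t"
  using assms
proof (induction t)
  case (Op f ts)
  then have "map (eval M v) ts = map (eval M w) ts" by auto
  then show ?case by (simp only: eval.simps)
qed simp

lemma eval_subst: "eval M v (subst \<sigma> t) = eval M (\<lambda>x. eval M v (\<sigma> x)) t"
  by (induction t) (simp_all add: comp_def cong: map_cong)

lemma wf_trm_subst: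
  assumes "wf_trm ar t" "\<And>x. x \<in> tvars t \<Longrightarrow> wf_trm ar (\<sigma> x)"
  shows "wf_trm ar (subst \<sigma> t)"
  using assms by (induction t) auto

lemma term_op_Op: "term_op M (Op f ts) xs = interp M f (map (\<lambda>t. term_op M t xs) ts)"
  by (simp add: term_op_def)

lemma nary_term_OpD: "nary_term ar m (Op f ts) \<Longrightarrow> t \<in> set ts \<Longrightarrow> nary_term ar m t"
  by (auto simp: nary_term_def)

(* The default c replaces the unspecified values of nth beyond the length of the list. *)
lemma term_op_eq_eval:
  assumes "nary_term ar (length xs) t"
  shows "term_op M t xs = eval M (\<lambda>i. if i < length xs then xs ! i else c) t"
  unfolding term_op_def by (rule eval_cong_tvars) (use assms in \<open>auto simp: nary_term_def\<close>)

lemma map_in_nlists: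
  "xs \<in> nlists m S \<Longrightarrow> (\<And>x. x \<in> S \<Longrightarrow> f x \<in> S') \<Longrightarrow> map f xs \<in> nlists m S'"
  by (auto simp: nlists_def)

lemma interp_closed:
  "is_algebra ar M \<Longrightarrow> xs \<in> nlists (ar f) (carrier M) \<Longrightarrow> interp M f xs \<in> carrier M"
  by (simp add: is_algebra_def)

lemma hom_interp:
  "hom ar M N h \<Longrightarrow> xs \<in> nlists (ar f) (carrier M) \<Longrightarrow> h (interp M f xs) = interp N f (map h xs)"
  by (simp add: hom_def)

lemma zero_closed: "is_algebra ar M \<Longrightarrow> ar z = 0 \<Longrightarrow> zero z M \<in> carrier M"
  by (simp add: is_algebra_def)

lemma hom_zero: "hom ar M N h \<Longrightarrow> ar z = 0 \<Longrightarrow> h (zero z M) = zero z N"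
  by (simp add: hom_def)

lemma hom_closed: "hom ar M N h \<Longrightarrow> x \<in> carrier M \<Longrightarrow> h x \<in> carrier N"
  by (auto simp: hom_def)

lemma term_op_closed:
  assumes "is_algebra ar M" "ar z = 0" "nary_term ar (length xs) t" "set xs \<subseteq> carrier M"
  shows "term_op M t xs \<in> carrier M"
proof -
  \<comment> \<open>The default \<open>zero z M\<close> keeps the total valuation inside the
    carrier, as \<open>eval_closed\<close> demands at every variable.\<close>
  have "range (\<lambda>i. if i < length xs then xs ! i else zero z M) \<subseteq> carrier M"
    using assms(4) zero_closed[of ar M z] assms(1,2) by auto
  then show ?thesis
    unfolding term_op_eq_eval[OF assms(3), of M "zero z M"]
    by (rule eval_closed[OF assms(1)]) (use assms(3) in \<open>simp add: nary_term_def\<close>)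
qed

lemma term_op_hom:
  assumes "is_algebra ar M" "hom ar M N h" "ar z = 0" "nary_term ar (length xs) t"
    "set xs \<subseteq> carrier M"
  shows "h (term_op M t xs) = term_op N t (map h xs)"
proof -
  let ?v = "\<lambda>i. if i < length xs then xs ! i else zero z M"
  have v: "range ?v \<subseteq> carrier M"
    using assms(5) zero_closed[of ar M z] assms(1,3) by auto
  have "h (term_op M t xs) = eval N (\<lambda>i. h (?v i)) t"
    unfolding term_op_eq_eval[OF assms(4), of M "zero z M"]
    by (rule eval_hom[OF assms(1,2) v]) (use assms(4) in \<open>simp add: nary_term_def\<close>)
  also have "\<dots> = term_op N t (map h xs)"
    unfolding term_op_def by (rule eval_cong_tvars) (use assms(4) in \<open>auto simp: nary_term_def\<close>)
  finally show ?thesis .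
qed

text \<open>Turns the syntactic identity, stated over one fixed carrier type, into an equation
  between elements of an algebra of the variety on any type.\<close>

lemma term_op_theta:
  assumes E: "wf_identities ar E" and z: "ar z = 0" and \<theta>: "nary_term ar (n + 1) \<theta>"
    and holds: "holds_in_variety ar E (theta_identity z n \<theta>)"
    and M: "in_variety ar E M" and x: "x \<in> carrier M"
  shows "term_op M \<theta> (replicate n (zero z M) @ [x]) = x"
proof -
  let ?\<sigma> = "nth (replicate n (Op z []) @ [Var (0 :: nat)])"
  \<comment> \<open>An (n + 1)-ary term uses only the indices 0, ..., n; index n is the last
    position, to which the substitution assigns \<open>Var 0\<close>.\<close>
  have vars: "x < n \<or> x = n" if "x \<in> tvars \<theta>" for x
    using \<theta> that by (auto simp: nary_term_def)
  have "wf_trm ar (subst ?\<sigma> \<theta>)"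
    using \<theta> z by (intro wf_trm_subst) (auto simp: nary_term_def nth_append dest!: vars)
  then have sat: "satisfies M (theta_identity z n \<theta>)"
    using holds_in_variety_satisfies[OF E holds _ _ M] by (simp add: theta_identity_def)
  \<comment> \<open>The substituted term contains no variable other than \<open>Var 0\<close>, so
    the constant valuation at x serves, and its range lies in the carrier.\<close>
  have "eval M (\<lambda>_. x) (subst ?\<sigma> \<theta>) = x"
    using sat[unfolded satisfies_def, rule_format, of "\<lambda>_. x"] x by (simp add: theta_identity_def)
  moreover have "eval M (\<lambda>i. eval M (\<lambda>_. x) (?\<sigma> i)) \<theta> = term_op M \<theta> (replicate n (zero z M) @ [x])"
    unfolding term_op_def by (rule eval_cong_tvars)
      (auto simp: nth_append dest!: vars)
  ultimately show ?thesis by (simp add: eval_subst)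
qed

section \<open>Transport of split extensions along isomorphisms\<close>

lemma hom_comp:
  assumes "hom ar L M g" "hom ar M N h"
  shows "hom ar L N (h \<circ> g)"
  unfolding hom_def
proof (intro conjI allI ballI)
  show "(h \<circ> g) ` carrier L \<subseteq> carrier N"
    using assms by (auto intro: hom_closed)
next
  fix f xs assume xs: "xs \<in> nlists (ar f) (carrier L)"
  then have "map g xs \<in> nlists (ar f) (carrier M)"
    by (rule map_in_nlists) (rule hom_closed[OF assms(1)])
  then show "(h \<circ> g) (interp L f xs) = interp N f (map (h \<circ> g) xs)"
    using hom_interp[OF assms(1) xs] hom_interp[OF assms(2)] by simp
qed

text \<open>Being a homomorphism concerns values on the carrier only; closure of M under its
  operations covers the value \<open>h (interp M f xs)\<close>.\<close>

lemma hom_cong: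
  assumes g: "hom ar M N g" and M: "is_algebra ar M" and eq: "\<And>x. x \<in> carrier M \<Longrightarrow> h x = g x"
  shows "hom ar M N h"
  unfolding hom_def
proof (intro conjI allI ballI)
  show "h ` carrier M \<subseteq> carrier N"
    using hom_closed[OF g] eq by auto
next
  fix f xs assume xs: "xs \<in> nlists (ar f) (carrier M)"
  then have "map h xs = map g xs" using eq by (auto simp: nlists_def)
  then show "h (interp M f xs) = interp N f (map h xs)"
    using hom_interp[OF g xs] eq[OF interp_closed[OF M xs]] by metis
qed

lemma iso_inverse:
  assumes \<phi>: "iso ar M N \<phi>" and M: "is_algebra ar M"
    and \<psi>: "\<And>x. x \<in> carrier M \<Longrightarrow> \<psi> (\<phi> x) = x"
  shows "iso ar N M \<psi>"
proof -
  have im: "carrier N = \<phi> ` carrier M" and hom: "hom ar M N \<phi>"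
    using \<phi> by (auto simp: iso_def bij_betw_def)
  have "\<psi> (interp N f ys) = interp M f (map \<psi> ys)" if ys: "ys \<in> nlists (ar f) (carrier N)" for f ys
  proof -
    let ?xs = "map \<psi> ys"
    \<comment> \<open>Surjectivity of \<phi> makes its left inverse \<psi> a right inverse as well,
      so arguments from N can be pulled back to M and pushed forward again.\<close>
    have *: "\<psi> y \<in> carrier M \<and> \<phi> (\<psi> y) = y" if "y \<in> set ys" for y
      using ys that \<psi> unfolding im nlists_def by force
    then have xs: "?xs \<in> nlists (ar f) (carrier M)"
      using ys by (auto simp: nlists_def)
    have "map \<phi> ?xs = ys"
      unfolding map_map by (rule map_idI) (simp add: *)
    then have "interp N f ys = \<phi> (interp M f ?xs)" using hom_interp[OF hom xs] by simp
    then show ?thesis using interp_closed[OF M xs] \<psi> by simp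
  qed
  moreover have "bij_betw \<psi> (carrier N) (carrier M)"
    unfolding im by (rule bij_betw_byWitness[where f' = \<phi>]) (auto simp: \<psi>)
  ultimately show ?thesis by (auto simp: iso_def hom_def bij_betw_def)
qed

text \<open>On the carriers the new maps are composites of the old ones with \<phi> or its inverse,
  so each condition carries over from A to Y.\<close>

lemma split_extension_transport:
  assumes E: "wf_identities ar E"
    and ext: "split_extension ar E z X k A p s B"
    and Y: "is_algebra ar Y" and \<phi>: "iso ar A Y \<phi>"
    and k': "\<And>x. x \<in> carrier X \<Longrightarrow> k' x = \<phi> (k x)"
    and p': "\<And>a. a \<in> carrier A \<Longrightarrow> p' (\<phi> a) = p a"
    and s': "\<And>b. b \<in> carrier B \<Longrightarrow> s' b = \<phi> (s b)"
  shows "split_extension ar E z X k' Y p' s' B"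
    and "split_ext_isomorphic ar X B k A p s k' Y p' s'"
proof -
  define \<psi> where "\<psi> = inv_into (carrier A) \<phi>"
  have alg: "is_algebra ar X" "is_algebra ar A" "is_algebra ar B"
    and homs: "hom ar X A k" "hom ar A B p" "hom ar B A s"
    and kbij: "bij_betw k (carrier X) {a \<in> carrier A. p a = zero z B}"
    using ext by (auto simp: split_extension_def in_variety_def is_kernel_def)
  have hom\<phi>: "hom ar A Y \<phi>" and inj\<phi>: "inj_on \<phi> (carrier A)" and im: "carrier Y = \<phi> ` carrier A"
    using \<phi> by (auto simp: iso_def bij_betw_def)
  have \<psi>\<phi>: "\<psi> (\<phi> a) = a" if "a \<in> carrier A" for a
    using inj\<phi> that by (simp add: \<psi>_def)
  have iso\<psi>: "iso ar Y A \<psi>" by (rule iso_inverse[OF \<phi> alg(2) \<psi>\<phi>])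
  then have hom\<psi>: "hom ar Y A \<psi>" and inj\<psi>: "inj_on \<psi> (carrier Y)"
    by (auto simp: iso_def bij_betw_def)
  \<comment> \<open>Identities are inherited along an injective homomorphism out of Y, hence the use
    of \<psi> and not of \<phi>.\<close>
  have "in_variety ar E Y"
    using in_variety_inj_hom[OF E _ Y hom\<psi> inj\<psi>] ext by (simp add: split_extension_def)
  moreover have "hom ar Y B p'"
    by (rule hom_cong[OF hom_comp[OF hom\<psi> homs(2)] Y]) (auto simp: im p' \<psi>\<phi>)
  moreover have "hom ar B Y s'"
    by (rule hom_cong[OF hom_comp[OF homs(3) hom\<phi>] alg(3)]) (simp add: s')
  moreover have "hom ar X Y k'"
    by (rule hom_cong[OF hom_comp[OF homs(1) hom\<phi>] alg(1)]) (simp add: k')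
  moreover have "bij_betw k' (carrier X) {y \<in> carrier Y. p' y = zero z B}"
  proof -
    \<comment> \<open>Since p' \<phi> = p, the map \<phi> restricts to a bijection between the zero
      fibres of p and p'.\<close>
    have "bij_betw \<phi> {a \<in> carrier A. p a = zero z B} (\<phi> ` {a \<in> carrier A. p a = zero z B})"
      using inj\<phi> by (auto simp: bij_betw_def intro: inj_on_subset)
    moreover have "\<phi> ` {a \<in> carrier A. p a = zero z B} = {y \<in> carrier Y. p' y = zero z B}"
      by (auto simp: im p')
    ultimately have "bij_betw (\<phi> \<circ> k) (carrier X) {y \<in> carrier Y. p' y = zero z B}"
      using bij_betw_trans[OF kbij] by simp
    then show ?thesis by (subst bij_betw_cong[where g = "\<phi> \<circ> k"]) (simp_all add: k')
  qed
  moreover have "p' (s' b) = b" if "b \<in> carrier B" for b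
    using that s' p' hom_closed[OF homs(3)] ext by (simp add: split_extension_def)
  ultimately show "split_extension ar E z X k' Y p' s' B"
    using ext by (simp add: split_extension_def is_kernel_def)
  show "split_ext_isomorphic ar X B k A p s k' Y p' s'"
    unfolding split_ext_isomorphic_def using \<phi> k' p' s' by auto
qed

section \<open>Weakly Schreier split extensions\<close>

text \<open>Fixing one witness q makes the results available both for an arbitrary witness and for
  one that vanishes on the image of s.\<close>

locale schreier_split_extension =
  fixes ar :: "'f \<Rightarrow> nat" and E :: "'f identity set" and z :: 'f
    and n :: nat and \<theta> :: "('f, nat) trm"
    and X :: "('f, 'x) algebra" and A :: "('f, 'a) algebra" and B :: "('f, 'b) algebra"
    and k :: "'x \<Rightarrow> 'a" and p :: "'a \<Rightarrow> 'b" and s :: "'b \<Rightarrow> 'a" and q :: "nat \<Rightarrow> 'a \<Rightarrow> 'x"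
  assumes E: "wf_identities ar E" and z: "ar z = 0"
    and \<theta>: "nary_term ar (n + 1) \<theta>" "holds_in_variety ar E (theta_identity z n \<theta>)"
    and ext: "split_extension ar E z X k A p s B"
    and q: "schreier_witness n \<theta> X k A p s q"
begin

section \<open>Coordinates for the elements of A\<close>

definition T :: "'x list \<times> 'b \<Rightarrow> 'a" where
  "T = (\<lambda>(xs, b). term_op A \<theta> (map k xs @ [s b]))"

definition \<phi> :: "'a \<Rightarrow> 'x list \<times> 'b" where
  "\<phi> a = (map (\<lambda>i. q i a) [0..<n], p a)"

abbreviation Y :: "('f, 'x list \<times> 'b) algebra" where
  "Y \<equiv> Y_algebra n \<theta> X k A s B q"

lemma algebras: "is_algebra ar X" "is_algebra ar A" "is_algebra ar B"
  and varieties: "in_variety ar E X" "in_variety ar E A" "in_variety ar E B"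
  and homs: "hom ar X A k" "hom ar A B p" "hom ar B A s"
  and inj_k: "inj_on k (carrier X)"
  and k_image: "k ` carrier X = {a \<in> carrier A. p a = zero z B}"
  and p_s: "b \<in> carrier B \<Longrightarrow> p (s b) = b"
  using ext by (auto simp: split_extension_def in_variety_def is_kernel_def bij_betw_def)

lemmas hom_zeros = homs[THEN hom_zero, OF z]
lemmas zeros_closed = algebras[THEN zero_closed, OF z]
lemmas theta_zeros = varieties[THEN term_op_theta[OF E z \<theta>]]

lemma p_k: "x \<in> carrier X \<Longrightarrow> p (k x) = zero z B"
  using k_image by auto

lemma q_closed: "i < n \<Longrightarrow> a \<in> carrier A \<Longrightarrow> q i a \<in> carrier X"
  using q by (auto simp: schreier_witness_def)

lemma T_closed:
  assumes "w \<in> nlists n (carrier X) \<times> carrier B"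
  shows "T w \<in> carrier A"
proof -
  obtain xs b where w: "w = (xs, b)" by force
  then have "set (map k xs @ [s b]) \<subseteq> carrier A" "length (map k xs @ [s b]) = n + 1"
    using assms hom_closed[OF homs(1)] hom_closed[OF homs(3)] by (auto simp: nlists_def)
  then show ?thesis
    using term_op_closed[OF algebras(2) z] \<theta>(1) w by (simp add: T_def)
qed

lemma p_T:
  assumes "w \<in> nlists n (carrier X) \<times> carrier B"
  shows "p (T w) = snd w"
proof -
  obtain xs b where w: "w = (xs, b)" by force
  then have *: "set (map k xs @ [s b]) \<subseteq> carrier A" "length (map k xs @ [s b]) = n + 1"
    and xs: "set xs \<subseteq> carrier X" "length xs = n" and b: "b \<in> carrier B"
    using assms hom_closed[OF homs(1)] hom_closed[OF homs(3)] by (auto simp: nlists_def)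
  \<comment> \<open>The homomorphism p sends the arguments of \<theta> to (0, ..., 0, b), on which
    \<theta> returns b.\<close>
  have "map p (map k xs @ [s b]) = replicate n (zero z B) @ [b]"
    using xs p_s[OF b] by (auto intro!: replicate_eqI p_k)
  then show ?thesis
    using term_op_hom[OF algebras(2) homs(2) z _ *(1)] *(2) \<theta>(1) theta_zeros(3)[OF b]
    by (simp add: w T_def)
qed

lemma T_\<phi>: "a \<in> carrier A \<Longrightarrow> T (\<phi> a) = a"
  using q by (simp add: schreier_witness_def T_def \<phi>_def comp_def)

lemma \<phi>_closed: "a \<in> carrier A \<Longrightarrow> \<phi> a \<in> nlists n (carrier X) \<times> carrier B"
  using q_closed hom_closed[OF homs(2)] by (auto simp: \<phi>_def nlists_def)

text \<open>The defining formula rebuilds elements of A with \<open>T\<close>, applies the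
  operation, and takes the list coordinates of the result. Facts about \<open>gamma\<close> are
  derived from this form.\<close>

lemma gamma_eq: "gamma n \<theta> k A s q \<omega> ws = fst (\<phi> (\<omega> (map T ws)))"
  by (simp add: gamma_def \<phi>_def T_def)

section \<open>The algebra Y as the image of \<phi>\<close>

lemma carrier_Y_eq: "carrier Y = {w \<in> nlists n (carrier X) \<times> carrier B. fst (\<phi> (T w)) = fst w}"
  by (auto simp: Y_algebra_def gamma_eq term_op_def)

lemma carrier_Y_\<phi>: "carrier Y = \<phi> ` carrier A"
proof
  show "carrier Y \<subseteq> \<phi> ` carrier A"
  proof
    fix w assume "w \<in> carrier Y"
    then have w: "w \<in> nlists n (carrier X) \<times> carrier B" "fst (\<phi> (T w)) = fst w"
      by (auto simp: carrier_Y_eq)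
    \<comment> \<open>Membership in Y controls only the list component; \<open>p_T\<close> supplies
      the component in B.\<close>
    then have "\<phi> (T w) = w"
      using p_T[OF w(1)] by (simp add: \<phi>_def prod_eq_iff)
    then show "w \<in> \<phi> ` carrier A" using T_closed[OF w(1)] by force
  qed
  show "\<phi> ` carrier A \<subseteq> carrier Y"
    unfolding carrier_Y_eq by (rule image_subsetI) (simp add: \<phi>_closed T_\<phi>)
qed

text \<open>The operations of Y are those of A transported along \<phi>: the list component is
  \<open>gamma_eq\<close>, and the B-component agrees because p is a homomorphism with p (T w) =
  \<open>snd w\<close>.\<close>

lemma interp_Y:
  assumes "ws \<in> nlists (ar f) (nlists n (carrier X) \<times> carrier B)"
  shows "interp Y f ws = \<phi> (interp A f (map T ws))"
proof -
  have sub: "set ws \<subseteq> nlists n (carrier X) \<times> carrier B" using assms by (simp add: nlists_def)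
  then have "map T ws \<in> nlists (ar f) (carrier A)"
    using assms T_closed by (auto simp: nlists_def)
  moreover have "map p (map T ws) = map snd ws"
    using sub p_T by auto
  ultimately have "p (interp A f (map T ws)) = interp B f (map snd ws)"
    using hom_interp[OF homs(2)] by metis
  then show ?thesis by (simp add: Y_algebra_def gamma_eq \<phi>_def)
qed

lemma algebra_Y: "is_algebra ar Y"
  unfolding is_algebra_def
proof (intro allI ballI)
  fix f ws assume "ws \<in> nlists (ar f) (carrier Y)"
  then have ws: "ws \<in> nlists (ar f) (nlists n (carrier X) \<times> carrier B)"
    by (auto simp: nlists_def carrier_Y_eq)
  then have "map T ws \<in> nlists (ar f) (carrier A)"
    using T_closed by (auto simp: nlists_def)
  then have "interp A f (map T ws) \<in> carrier A"
    by (rule interp_closed[OF algebras(2)])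
  then show "interp Y f ws \<in> carrier Y"
    using interp_Y[OF ws] carrier_Y_\<phi> by simp
qed

lemma iso_\<phi>: "iso ar A Y \<phi>"
  unfolding iso_def hom_def
proof (intro conjI allI ballI)
  show "\<phi> ` carrier A \<subseteq> carrier Y" by (simp add: carrier_Y_\<phi>)
  show "bij_betw \<phi> (carrier A) (carrier Y)"
    unfolding carrier_Y_\<phi> by (auto simp: bij_betw_def intro: inj_on_inverseI[of _ T] T_\<phi>)
next
  fix f as assume as: "as \<in> nlists (ar f) (carrier A)"
  then have "map \<phi> as \<in> nlists (ar f) (nlists n (carrier X) \<times> carrier B)"
    by (rule map_in_nlists) (rule \<phi>_closed)
  \<comment> \<open>\<open>T\<close> undoes \<phi>, so the transported operation on the images is
    \<phi> of the operation in A.\<close>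
  moreover have "map T (map \<phi> as) = as"
    unfolding map_map by (rule map_idI) (use as T_\<phi> in \<open>auto simp: nlists_def\<close>)
  ultimately show "\<phi> (interp A f as) = interp Y f (map \<phi> as)"
    by (metis interp_Y)
qed

section \<open>Kernel map and section of Y\<close>

lemma k_theta:
  assumes "ys \<in> nlists n (carrier X)"
  shows "k (term_op X \<theta> (ys @ [zero z X])) = T (ys, zero z B)"
proof -
  have "set (ys @ [zero z X]) \<subseteq> carrier X" "length (ys @ [zero z X]) = n + 1"
    using assms zeros_closed by (auto simp: nlists_def)
  \<comment> \<open>As k preserves \<theta>, it remains to match the last arguments: k 0 = 0 = s
    0.\<close>
  then show ?thesis
    using term_op_hom[OF algebras(1) homs(1) z] \<theta>(1) hom_zeros by (simp add: T_def)
qed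

lemma kernel_elt_iff:
  assumes x: "x \<in> carrier X"
  shows "kernel_elt z \<theta> X B Y x w \<longleftrightarrow> w = \<phi> (k x)"
proof -
  have kx: "k x \<in> carrier A" using hom_closed[OF homs(1) x] .
  show ?thesis
  proof
    assume w: "kernel_elt z \<theta> X B Y x w"
    then obtain a where a: "a \<in> carrier A" "w = \<phi> a"
      by (auto simp: kernel_elt_def carrier_Y_\<phi>)
    \<comment> \<open>Applying k to \<theta>(ys, 0) = x gives k x = T w. As w = \<phi> a and T
      (\<phi> a) = a, this forces a = k x.\<close>
    have "k x = T (fst w, snd w)"
      using w k_theta by (auto simp: kernel_elt_def carrier_Y_eq)
    then show "w = \<phi> (k x)" using a T_\<phi> by simp
  next
    assume w: "w = \<phi> (k x)"
    then have Y: "w \<in> carrier Y" and snd: "snd w = zero z B" and fst: "fst w \<in> nlists n (carrier X)"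
      using kx p_k[OF x] \<phi>_closed[OF kx] by (auto simp: carrier_Y_\<phi> \<phi>_def)
    have "set (fst w @ [zero z X]) \<subseteq> carrier X" "length (fst w @ [zero z X]) = n + 1"
      using fst zeros_closed by (auto simp: nlists_def)
    then have "term_op X \<theta> (fst w @ [zero z X]) \<in> carrier X"
      using term_op_closed[OF algebras(1) z] \<theta>(1) by simp
    \<comment> \<open>Both sides are values of k on the carrier of X, so injectivity of k yields the
      equation in X.\<close>
    moreover have "k (term_op X \<theta> (fst w @ [zero z X])) = k x"
      using k_theta[OF fst] T_\<phi>[OF kx] snd w by (metis prod.collapse)
    ultimately show "kernel_elt z \<theta> X B Y x w"
      using Y snd inj_k x by (auto simp: kernel_elt_def dest: inj_onD)
  qed
qed

lemma kernel_map_eq: "x \<in> carrier X \<Longrightarrow> kernel_map z \<theta> X B Y x = \<phi> (k x)"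
  by (simp add: kernel_map_def kernel_elt_iff)

text \<open>The section s' is constrained only on the carrier of B, so that it can be \<phi>
  composed with s or, for a normalized witness, \<open>iota\<close>.\<close>

lemma split_extension_Y:
  assumes "\<And>b. b \<in> carrier B \<Longrightarrow> s' b = (map (\<lambda>i. q i (s b)) [0..<n], b)"
  shows "split_extension ar E z X (kernel_map z \<theta> X B Y) Y snd s' B"
    and "split_ext_isomorphic ar X B k A p s (kernel_map z \<theta> X B Y) Y snd s'"
  by (rule split_extension_transport[OF E ext algebra_Y iso_\<phi>];
      simp add: assms kernel_map_eq \<phi>_def p_s)+

section \<open>The description of Y by \<theta>, and composite terms\<close>

lemma carrier_Y_theta:
  "carrier Y = {(xs, b) \<in> nlists n (carrier X) \<times> carrier B.
     gamma n \<theta> k A s q (term_op A \<theta>)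
       (replicate n (replicate n (zero z X), zero z B) @ [(xs, b)]) = xs}"
proof -
  \<comment> \<open>\<open>T\<close> sends zero to zero, so evaluating \<theta> in A leaves
    \<theta>(0, ..., 0, T w) = T w, the same value that the term \<open>id\<close> gives.\<close>
  have "T (replicate n (zero z X), zero z B) = zero z A"
    using hom_zeros theta_zeros(2)[OF zeros_closed(2)] by (simp add: T_def)
  then have "term_op A \<theta> (map T (replicate n (replicate n (zero z X), zero z B) @ [w])) = T w"
    if "w \<in> nlists n (carrier X) \<times> carrier B" for w
    using theta_zeros(2)[OF T_closed[OF that]] by simp
  then show ?thesis
    unfolding gamma_eq carrier_Y_eq by fastforce
qed

text \<open>This recursion determines \<open>gamma\<close> on composite terms from the basic
  operations: the value of each subterm enters through its coordinates, from which \<open>T\<close>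
  recovers it.\<close>

lemma gamma_Op:
  assumes t: "nary_term ar (length ws) (Op f ts)"
    and ws: "set ws \<subseteq> nlists n (carrier X) \<times> carrier B"
  shows "gamma n \<theta> k A s q (term_op A (Op f ts)) ws =
    gamma n \<theta> k A s q (interp A f)
      (map (\<lambda>t. (gamma n \<theta> k A s q (term_op A t) ws, term_op B t (map snd ws))) ts)"
proof -
  have Tws: "set (map T ws) \<subseteq> carrier A" using ws T_closed by auto
  have p_Tws: "map p (map T ws) = map snd ws"
    unfolding map_map by (rule map_cong) (use ws p_T in auto)
  have "T (gamma n \<theta> k A s q (term_op A t) ws, term_op B t (map snd ws)) = term_op A t (map T ws)"
    if "t \<in> set ts" for t
  proof -
    have t': "nary_term ar (length (map T ws)) t" using nary_term_OpD[OF t that] by simp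
    \<comment> \<open>This identifies the B-component, so the pair for t is \<phi> of the value of t
      in A.\<close>
    have "p (term_op A t (map T ws)) = term_op B t (map snd ws)"
      using term_op_hom[OF algebras(2) homs(2) z t' Tws] unfolding p_Tws .
    then have "(gamma n \<theta> k A s q (term_op A t) ws, term_op B t (map snd ws)) =
        \<phi> (term_op A t (map T ws))"
      by (simp add: gamma_eq \<phi>_def)
    then show ?thesis using T_\<phi> term_op_closed[OF algebras(2) z t' Tws] by simp
  qed
  then have "map T (map (\<lambda>t. (gamma n \<theta> k A s q (term_op A t) ws, term_op B t (map snd ws))) ts) =
      map (\<lambda>t. term_op A t (map T ws)) ts"
    by simp
  then show ?thesis by (simp only: gamma_eq term_op_Op)
qed

section \<open>Witnesses vanishing on the image of s\<close>

lemma normalized_witness: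
  "\<exists>r. schreier_witness n \<theta> X k A p s r \<and> (\<forall>i<n. \<forall>b\<in>carrier B. r i (s b) = zero z X)"
proof (intro exI conjI)
  let ?r = "\<lambda>i a. if a \<in> s ` carrier B then zero z X else q i a"
  show "\<forall>i<n. \<forall>b\<in>carrier B. ?r i (s b) = zero z X" by simp
  have "term_op A \<theta> (map (\<lambda>i. k (?r i a)) [0..<n] @ [s (p a)]) = a" if a: "a \<in> carrier A" for a
  proof (cases "a \<in> s ` carrier B")
    case True
    \<comment> \<open>With zeros for the first n arguments, \<theta> returns its last argument s (p
      a), which is a itself here.\<close>
    then have "s (p a) = a" using p_s by auto
    then show ?thesis
      using theta_zeros(2)[OF a] True hom_zeros by (simp add: map_replicate_const)
  next
    case False
    then show ?thesis using q a by (simp add: schreier_witness_def)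
  qed
  then show "schreier_witness n \<theta> X k A p s ?r"
    using q_closed zeros_closed by (auto simp: schreier_witness_def)
qed

lemma iota_eq:
  assumes "\<forall>i<n. \<forall>b\<in>carrier B. q i (s b) = zero z X" "b \<in> carrier B"
  shows "iota z n X b = (map (\<lambda>i. q i (s b)) [0..<n], b)"
  using assms by (auto simp: iota_def intro!: replicate_eqI[symmetric])

end

text \<open>The section matching s under \<phi> is b \<mapsto> \<phi> (s b), which is the
  \<open>\<sigma>\<close> below. It equals \<open>iota\<close> on B when the witness vanishes on the
  image of s, and the existence claim uses such a witness.\<close>

theorem proposition3p2:
  fixes ar :: "'f \<Rightarrow> nat" and E :: "'f identity set" and z :: 'f
    and n :: nat and \<theta> :: "('f, nat) trm"
    and X :: "('f, 'x) algebra" and A :: "('f, 'a) algebra" and B :: "('f, 'b) algebra"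
    and k :: "'x \<Rightarrow> 'a" and p :: "'a \<Rightarrow> 'b" and s :: "'b \<Rightarrow> 'a"
  assumes variety: "wf_identities ar E"
    and const: "unique_constant ar E z"
    and theta: "nary_term ar (n + 1) \<theta>" "holds_in_variety ar E (theta_identity z n \<theta>)"
    and ext: "weakly_schreier ar E z n \<theta> X k A p s B"
  shows
    "(\<exists>Y :: ('f, 'x list \<times> 'b) algebra.
        carrier Y \<subseteq> nlists n (carrier X) \<times> carrier B \<and>
        (\<forall>x\<in>carrier X. \<exists>!w. kernel_elt z \<theta> X B Y x w) \<and>
        split_extension ar E z X (kernel_map z \<theta> X B Y) Y snd (iota z n X) B \<and>
        split_ext_isomorphic ar X B k A p s (kernel_map z \<theta> X B Y) Y snd (iota z n X)) \<and>
     (\<exists>q. schreier_witness n \<theta> X k A p s q \<and> (\<forall>i<n. \<forall>b\<in>carrier B. q i (s b) = zero z X)) \<and>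
     (\<forall>q. schreier_witness n \<theta> X k A p s q \<and> (\<forall>i<n. q i (zero z A) = zero z X) \<longrightarrow>
        (let \<gamma> = gamma n \<theta> k A s q; Y = Y_algebra n \<theta> X k A s B q;
             k' = kernel_map z \<theta> X B Y;
             \<sigma> = (\<lambda>b. (map (\<lambda>i. q i (s b)) [0..<n], b))
         in
           carrier Y = {(xs, b) \<in> nlists n (carrier X) \<times> carrier B.
                          \<gamma> (term_op A \<theta>) (replicate n (replicate n (zero z X), zero z B) @ [(xs, b)]) = xs} \<and>
           (\<forall>f ts ws. nary_term ar (length ws) (Op f ts) \<and>
                      set ws \<subseteq> nlists n (carrier X) \<times> carrier B \<longrightarrow>
              \<gamma> (term_op A (Op f ts)) ws =
              \<gamma> (interp A f) (map (\<lambda>t. (\<gamma> (term_op A t) ws, term_op B t (map snd ws))) ts)) \<and>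
           (\<forall>x\<in>carrier X. \<exists>!w. kernel_elt z \<theta> X B Y x w) \<and>
           split_extension ar E z X k' Y snd \<sigma> B \<and>
           split_ext_isomorphic ar X B k A p s k' Y snd \<sigma> \<and>
           ((\<forall>i<n. \<forall>b\<in>carrier B. q i (s b) = zero z X) \<longrightarrow>
              split_extension ar E z X k' Y snd (iota z n X) B \<and>
              split_ext_isomorphic ar X B k A p s k' Y snd (iota z n X))))"
proof -
  have ext': "split_extension ar E z X k A p s B" and z: "ar z = 0"
    using ext const by (auto simp: weakly_schreier_def unique_constant_def)
  have loc: "schreier_split_extension ar E z n \<theta> X A B k p s q"
    if "schreier_witness n \<theta> X k A p s q" for q
    using that variety z theta ext' by unfold_locales
  have norm: "\<exists>q. schreier_witness n \<theta> X k A p s q \<and>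
      (\<forall>i<n. \<forall>b\<in>carrier B. q i (s b) = zero z X)"
    using ext schreier_split_extension.normalized_witness[OF loc]
    by (auto simp: weakly_schreier_def)
  then obtain r where r: "schreier_witness n \<theta> X k A p s r"
    and r0: "\<forall>i<n. \<forall>b\<in>carrier B. r i (s b) = zero z X" by blast
  interpret r: schreier_split_extension ar E z n \<theta> X A B k p s r using loc[OF r] .
  show ?thesis
    unfolding Let_def
  proof (intro conjI[OF _ conjI[OF norm]] allI impI; (elim conjE)?)
    show "\<exists>Y :: ('f, 'x list \<times> 'b) algebra.
        carrier Y \<subseteq> nlists n (carrier X) \<times> carrier B \<and>
        (\<forall>x\<in>carrier X. \<exists>!w. kernel_elt z \<theta> X B Y x w) \<and>
        split_extension ar E z X (kernel_map z \<theta> X B Y) Y snd (iota z n X) B \<and>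
        split_ext_isomorphic ar X B k A p s (kernel_map z \<theta> X B Y) Y snd (iota z n X)"
      \<comment> \<open>The required Y is the one built from the normalized witness r.\<close>
      using r.split_extension_Y[OF r.iota_eq[OF r0]] r.kernel_elt_iff
      by (intro exI[of _ r.Y]) (auto simp: r.carrier_Y_eq)
  next
    fix q assume "schreier_witness n \<theta> X k A p s q"
    then interpret schreier_split_extension ar E z n \<theta> X A B k p s q by (rule loc)
    show "carrier Y = {(xs, b) \<in> nlists n (carrier X) \<times> carrier B.
        gamma n \<theta> k A s q (term_op A \<theta>)
          (replicate n (replicate n (zero z X), zero z B) @ [(xs, b)]) = xs} \<and>
      (\<forall>f ts ws. nary_term ar (length ws) (Op f ts) \<and>
          set ws \<subseteq> nlists n (carrier X) \<times> carrier B \<longrightarrow>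
        gamma n \<theta> k A s q (term_op A (Op f ts)) ws =
        gamma n \<theta> k A s q (interp A f)
          (map (\<lambda>t. (gamma n \<theta> k A s q (term_op A t) ws, term_op B t (map snd ws))) ts)) \<and>
      (\<forall>x\<in>carrier X. \<exists>!w. kernel_elt z \<theta> X B Y x w) \<and>
      split_extension ar E z X (kernel_map z \<theta> X B Y) Y snd (\<lambda>b. (map (\<lambda>i. q i (s b)) [0..<n], b)) B \<and>
      split_ext_isomorphic ar X B k A p s (kernel_map z \<theta> X B Y) Y snd
        (\<lambda>b. (map (\<lambda>i. q i (s b)) [0..<n], b)) \<and>
      ((\<forall>i<n. \<forall>b\<in>carrier B. q i (s b) = zero z X) \<longrightarrow>
        split_extension ar E z X (kernel_map z \<theta> X B Y) Y snd (iota z n X) B \<and>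
        split_ext_isomorphic ar X B k A p s (kernel_map z \<theta> X B Y) Y snd (iota z n X))"
      using carrier_Y_theta gamma_Op split_extension_Y[OF refl] split_extension_Y[OF iota_eq]
      by (intro conjI allI impI ballI) (simp_all add: kernel_elt_iff)
  qed
qed

end
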